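(* Let $p$ be an odd prime and let $n,t,r$ be positive integers. Then $$f(x)=(1-x^t)x^{\frac{p^n-1}{2}+r}-x^r-x^{t+r}$$ is a permutation polynomial over $\mathbb{F}_{p^n}$ if and only if $\gcd(r,p^n-1)=1$ and $\gcd\left(t+r,\frac{p^n-1}{2}\right)=1$.
   Context: A polynomial is a permutation polynomial (PP) over a finite field if it induces a bijection of that field to itself. *)

theory Defs
  imports "HOL-Computational_Algebra.Computational_Algebra"
begin

definition permutation_polynomial :: "'a::{finite,field} poly \<Rightarrow> bool" where
  "permutation_polynomial f \<longleftrightarrow> bij (poly f)"

end

theory Submission
  imports Defs
begin

text \<open>Put $q = p^n$ and $h = (q-1)/2$. Since $x^h = \pm 1$ for $x \neq 0$, the polynomial acts as
  $-2x^{t+r}$ on the nonzero squares ($x^h = 1$) and as $-2x^r$ on the nonsquares ($x^h = -1$).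
  The power map $x \mapsto x^m$ is injective on the subgroup $x^h = 1$ iff $m$ is coprime to $h$, and
  $r$ has to be odd in order that nonsquares are not mapped into the image of the squares.\<close>

text \<open>Multiplication by \<open>x\<close> permutes the nonzero elements, so their product
  \<open>?P\<close> is unchanged when every factor is multiplied by \<open>x\<close>; cancel
  \<open>?P\<close>, which is nonzero.\<close>

lemma power_card_minus_1_eq_1:
  fixes x :: "'a::{finite,field}"
  assumes "x \<noteq> 0"
  shows "x ^ (card (UNIV :: 'a set) - 1) = 1"
proof -
  let ?P = "\<Prod>y\<in>UNIV-{0::'a}. y"
  have "bij_betw ((*) x) (UNIV-{0}) (UNIV-{0})"
    using assms by (intro bij_betwI[where g = "\<lambda>y. y / x"]) auto
  hence "?P = (\<Prod>y\<in>UNIV-{0}. x * y)"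
    by (rule prod.reindex_bij_betw[symmetric])
  also have "\<dots> = x ^ (card (UNIV :: 'a set) - 1) * ?P"
    by (simp add: prod.distrib card_Diff_singleton)
  finally show ?thesis by simp
qed

text \<open>Otherwise \<open>monom 1 m - 1\<close>, nonzero of degree at most \<open>m\<close>,
  would vanish at all nonzero elements, which outnumber \<open>m\<close>. This stands in for the
  cyclicity of the multiplicative group.\<close>

lemma exists_power_neq_1:
  assumes "0 < m" and "m < card (UNIV :: 'a::{finite,field} set) - 1"
  shows "\<exists>x::'a. x \<noteq> 0 \<and> x ^ m \<noteq> 1"
proof (rule ccontr)
  assume "\<not> ?thesis"
  hence sub: "UNIV - {0} \<subseteq> {x::'a. poly (monom 1 m - 1) x = 0}"
    by (auto simp: poly_monom)
  have "coeff (monom 1 m - 1 :: 'a poly) 0 = -1"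
    using assms(1) by simp
  hence nz: "monom 1 m - 1 \<noteq> (0 :: 'a poly)"
    by (metis coeff_0 neg_equal_0_iff_equal zero_neq_one)
  have "card (UNIV - {0::'a}) \<le> card {x::'a. poly (monom 1 m - 1) x = 0}"
    by (rule card_mono[OF _ sub]) simp
  also have "\<dots> \<le> degree (monom 1 m - 1 :: 'a poly)"
    by (rule card_poly_roots_bound[OF nz])
  also have "\<dots> \<le> m"
    by (rule degree_diff_le) (auto simp: degree_monom_le)
  finally show False
    using assms(2) by (simp add: card_Diff_singleton)
qed

lemma power_eq_1_coprime:
  fixes x :: "'a::field"
  assumes "x ^ a = 1" and "x ^ b = 1" and "coprime a b" and "a > 0"
  shows "x = 1"
proof -
  obtain u v where "a * u = b * v + 1"
    using bezout_nat[of a b] assms(3,4) by auto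
  hence "x ^ (a * u) = x ^ (b * v + 1)" by simp
  thus ?thesis using assms(1,2) by (simp add: power_mult power_add)
qed

text \<open>Supplies the collisions that refute injectivity. For a prime \<open>l\<close> dividing
  both \<open>m\<close> and \<open>h\<close>, an element of order \<open>l\<close> will do: a power
  with exponent \<open>2 * h / l\<close> that differs from 1.\<close>

lemma exists_common_root_of_unity:
  assumes "card (UNIV :: 'a::{finite,field} set) - 1 = 2 * h" and "h > 0" and "gcd m h \<noteq> 1"
  shows "\<exists>z::'a. z \<noteq> 1 \<and> z ^ m = 1 \<and> z ^ h = 1"
proof -
  obtain l where l: "prime l" "l dvd gcd m h"
    using assms(3) prime_factor_nat by blast
  obtain k j where k: "h = l * k" and j: "m = l * j"
    using l(2) by (auto elim!: dvdE)
  have "l > 1" using l(1) by (rule prime_gt_1_nat)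
  hence "0 < 2 * k" "2 * k < card (UNIV :: 'a set) - 1"
    using assms(1,2) k by auto
  then obtain y :: 'a where y: "y \<noteq> 0" "y ^ (2 * k) \<noteq> 1"
    using exists_power_neq_1 by blast
  have "(y ^ (2 * k)) ^ l = y ^ (2 * h)"
    unfolding k by (simp add: power_mult[symmetric] mult_ac)
  also have "\<dots> = 1"
    using power_card_minus_1_eq_1[OF y(1)] assms(1) by simp
  finally have "(y ^ (2 * k)) ^ l = 1" .
  thus ?thesis
    using y(2) unfolding k j by (intro exI[of _ "y ^ (2 * k)"]) (simp add: power_mult)
qed

theorem theorem2p4:
  fixes p n t r :: nat
    and f :: "'a::{finite,field} poly"
  assumes "prime p" and "odd p"
    and "n > 0" and "t > 0" and "r > 0"
    and "card (UNIV :: 'a set) = p ^ n"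
    and "f = (1 - monom 1 t) * monom 1 ((p ^ n - 1) div 2 + r) - monom 1 r - monom 1 (t + r)"
  shows "permutation_polynomial f \<longleftrightarrow>
    gcd r (p ^ n - 1) = 1 \<and> gcd (t + r) ((p ^ n - 1) div 2) = 1"
proof -
  define h where "h = (p ^ n - 1) div 2"
  have "odd (p ^ n)" using assms(2) by simp
  hence q: "p ^ n - 1 = 2 * h" by (simp add: h_def)
  have card: "card (UNIV :: 'a set) - 1 = 2 * h" using assms(6) q by simp
  have "p > 1" using assms(1) by (rule prime_gt_1_nat)
  hence "p ^ n > 1" using assms(3) by (rule one_less_power)
  hence h: "h > 0" using q by linarith
  have pow2h: "x ^ (2 * h) = 1" if "x \<noteq> 0" for x :: 'a
    using power_card_minus_1_eq_1[OF that] card by simp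
  have cases: "x ^ h = 1 \<or> x ^ h = -1" if "x \<noteq> 0" for x :: 'a
    using pow2h[OF that] by (simp add: mult.commute[of 2] power_mult power2_eq_1_iff)
  \<comment> \<open>The witness \<open>w\<close> is a nonsquare. Its existence also shows that the
    characteristic is not 2, since \<open>w ^ h\<close> is -1 but not 1.\<close>
  have "h < card (UNIV :: 'a set) - 1" using card h by simp
  then obtain w :: 'a where w: "w \<noteq> 0" "w ^ h \<noteq> 1"
    using exists_power_neq_1[OF h] by blast
  hence wh: "w ^ h = -1" using cases by blast
  hence neg: "(-1 :: 'a) \<noteq> 1" using w(2) by auto
  hence two: "(2 :: 'a) \<noteq> 0"
    by (metis add_eq_0_iff one_add_one)
  have f: "poly f x = (1 - x ^ t) * (x ^ h * x ^ r) - x ^ r - x ^ t * x ^ r" for x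
    unfolding assms(7) h_def[symmetric] by (simp add: poly_monom power_add)
  have f0: "poly f 0 = 0" using assms(5) by (simp add: f zero_power)
  have fS: "poly f x = -2 * x ^ (t + r)" if "x ^ h = 1" for x
    using that by (simp add: f power_add algebra_simps)
  have fN: "poly f x = -2 * x ^ r" if "x ^ h = -1" for x
    using that by (simp add: f algebra_simps)
  have gcd_r: "gcd r (p ^ n - 1) = 1 \<longleftrightarrow> odd r \<and> gcd r h = 1"
    unfolding q coprime_iff_gcd_eq_1[symmetric]
    by (simp only: coprime_mult_right_iff coprime_right_2_iff_odd)
  show ?thesis
    unfolding gcd_r h_def[symmetric]
  proof
    assume "permutation_polynomial f"
    hence inj: "x = y" if "poly f x = poly f y" for x y
      using that unfolding permutation_polynomial_def by (meson bij_is_inj injD)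
    have tr: "gcd (t + r) h = 1"
    proof (rule ccontr)
      assume "gcd (t + r) h \<noteq> 1"
      then obtain z :: 'a where z: "z \<noteq> 1" "z ^ (t + r) = 1" "z ^ h = 1"
        using exists_common_root_of_unity[OF card h] by blast
      hence "poly f z = poly f 1" by (simp add: fS)
      thus False using inj z(1) by blast
    qed
    have r: "gcd r h = 1"
    proof (rule ccontr)
      assume "gcd r h \<noteq> 1"
      then obtain z :: 'a where z: "z \<noteq> 1" "z ^ r = 1" "z ^ h = 1"
        using exists_common_root_of_unity[OF card h] by blast
      \<comment> \<open>As \<open>z ^ h = 1\<close>, the product \<open>z * w\<close> is again a
        nonsquare, and \<open>z ^ r = 1\<close> makes the two values agree.\<close>
      hence "poly f (z * w) = poly f w" by (simp add: fN wh power_mult_distrib)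
      thus False using inj z(1) w(1) by force
    qed
    have "odd r"
    proof
      assume "even r"
      hence wr: "(w ^ r) ^ h = 1"
        using wh by (metis power_mult mult.commute neg_one_even_power)
      \<comment> \<open>For even \<open>r\<close> the element \<open>w ^ r\<close> is a square.
        Since \<open>u\<close> inverts \<open>t + r\<close> modulo \<open>h\<close>, the square
        \<open>s = (w ^ r) ^ u\<close> is a root of order \<open>t + r\<close> of
        \<open>w ^ r\<close>, so \<open>f\<close> takes the same value at \<open>s\<close> and at
        the nonsquare \<open>w\<close>.\<close>
      obtain u v where uv: "(t + r) * u = h * v + 1"
        using bezout_nat[of "t + r" h] tr assms(5) by auto
      define s where "s = (w ^ r) ^ u"
      have sh: "s ^ h = 1"
        unfolding s_def by (metis wr power_mult mult.commute power_one)
      have "s ^ (t + r) = (w ^ r) ^ ((t + r) * u)"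
        unfolding s_def by (metis power_mult mult.commute)
      also have "\<dots> = w ^ r"
        unfolding uv power_add power_mult wr by simp
      finally have "poly f s = poly f w" using fS[OF sh] fN[OF wh] by simp
      hence "s = w" by (rule inj)
      thus False using sh w(2) by simp
    qed
    with r tr show "(odd r \<and> gcd r h = 1) \<and> gcd (t + r) h = 1" by simp
  next
    assume "(odd r \<and> gcd r h = 1) \<and> gcd (t + r) h = 1"
    hence r: "odd r" and cop: "coprime r h" "coprime (t + r) h"
      by (simp_all add: coprime_iff_gcd_eq_1)
    have powinj: "x = y"
      if "x ^ m = y ^ m" "x ^ h = y ^ h" "y \<noteq> 0" "coprime m h" "m > 0" for x y :: 'a and m
    proof -
      \<comment> \<open>Both the \<open>m\<close>-th and the \<open>h\<close>-th power of the
        quotient are 1.\<close>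
      have "x / y = 1"
        by (rule power_eq_1_coprime[of _ m h]) (use that in \<open>auto simp: power_divide\<close>)
      thus ?thesis using that(3) by simp
    qed
    have nz: "poly f x \<noteq> 0" if "x \<noteq> 0" for x
      using cases[OF that] that two by (auto simp: fS fN)
    have mixed: "poly f x \<noteq> poly f y" if "x ^ h = 1" "y ^ h = -1" for x y
    proof
      assume "poly f x = poly f y"
      hence "x ^ (t + r) = y ^ r" using that two by (simp add: fS fN)
      \<comment> \<open>The left side is 1, while the right side is -1 because \<open>r\<close> is
        odd.\<close>
      hence "(x ^ h) ^ (t + r) = (y ^ h) ^ r"
        by (metis power_mult mult.commute)
      thus False using that r neg by simp
    qed
    have "x = y" if eq: "poly f x = poly f y" for x y
    proof (cases "x = 0 \<or> y = 0")
      case True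
      thus ?thesis using eq nz f0 by metis
    next
      case False
      hence xy: "x \<noteq> 0" "y \<noteq> 0" by auto
      \<comment> \<open>Equal values force \<open>x\<close> and \<open>y\<close> into the same class
        by \<open>mixed\<close>, so on each class only injectivity of a single power map
        remains.\<close>
      consider "x ^ h = 1" "y ^ h = 1" | "x ^ h = -1" "y ^ h = -1"
        using cases[OF xy(1)] cases[OF xy(2)] mixed[of x y] mixed[of y x] eq by metis
      thus ?thesis
      proof cases
        case 1
        thus ?thesis using eq two cop(2) xy assms(5)
          by (intro powinj[of x "t + r" y]) (auto simp: fS)
      next
        case 2
        thus ?thesis using eq two cop(1) xy assms(5)
          by (intro powinj[of x r y]) (auto simp: fN)
      qed
    qed
    hence "inj (poly f)" by (rule injI)
    thus "permutation_polynomial f"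
      unfolding permutation_polynomial_def by (simp add: bij_def finite_UNIV_inj_surj)
  qed
qed

end
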